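(* Let $(X,d,\mu)$ be a metric measure space, where $\mu$ is a nontrivial Borel regular measure that is finite on bounded sets and positive on nonempty open sets. Let $u,g\in L^1_{\mathrm{loc}}(X)$ and suppose that $g$ is a Hajłasz gradient of $u$. Then there exist $\widetilde u,\widetilde g\in L^1_{\mathrm{loc}}(X)$ such that $\widetilde u=u$ and $\widetilde g=g$ $\mu$-almost everywhere and $4\widetilde g$ is an upper gradient of $\widetilde u$.
   Context: Gradients are allowed to take values in $[0,\infty]$. $L^1_{\mathrm{loc}}(X)$ denotes the locally integrable functions on $X$. Hajłasz gradient: given a measurable function $u$ on $X$, a non-negative measurable function $g$ on $X$ is a Hajłasz gradient of $u$ if there is a set $E\subset X$ with $\mu(E)=0$ such that $|u(x)-u(y)|\le d(x,y)[g(x)+g(y)]$ for all $x,y\in X\setminus E$. Upper gradient: a rectifiable curve is a continuous map from a compact interval into $X$ with finite length. A non-negative Borel function $g$ on $X$ is an upper gradient of a (pointwise defined) measurable function $u$ on $X$ if $|u(\gamma(a))-u(\gamma(b))|\le\int_\gamma g(s)\,ds$ for every non-constant rectifiable curve $\gamma:[a,b]\to X$, where the integral is with respect to arc length. *)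

theory Defs
  imports "HOL-Analysis.Analysis"
begin

text \<open>
  As usual in analysis on metric spaces, a Borel regular measure is an outer measure on all
  subsets of the space for which Borel sets are Caratheodory measurable and every set has a Borel
  hull of the same measure.  Measurability and integration refer to its Caratheodory measurable
  sets, so that the associated measure space is automatically complete.
\<close>

definition borel_regular :: "('a::metric_space set \<Rightarrow> ennreal) \<Rightarrow> bool" where
  "borel_regular \<mu> \<longleftrightarrow>
     outer_measure_space (Pow UNIV) \<mu> \<and>
     sets borel \<subseteq> lambda_system UNIV (Pow UNIV) \<mu> \<and>
     (\<forall>A. \<exists>B\<in>sets borel. A \<subseteq> B \<and> \<mu> B = \<mu> A)"

definition carath_measure :: "('a set \<Rightarrow> ennreal) \<Rightarrow> 'a measure" where
  "carath_measure \<mu> = measure_of UNIV (lambda_system UNIV (Pow UNIV) \<mu>) \<mu>"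

lemma space_carath_measure [simp]: "space (carath_measure \<mu>) = UNIV"
  unfolding carath_measure_def by (rule space_measure_of) simp

lemma
  assumes "outer_measure_space (Pow UNIV) \<mu>"
  shows sets_carath_measure: "sets (carath_measure \<mu>) = lambda_system UNIV (Pow UNIV) \<mu>"
    and emeasure_carath_measure:
      "A \<in> lambda_system UNIV (Pow UNIV) \<mu> \<Longrightarrow> emeasure (carath_measure \<mu>) A = \<mu> A"
proof -
  have ms: "measure_space UNIV (lambda_system UNIV (Pow UNIV) \<mu>) \<mu>"
    by (rule sigma_algebra.caratheodory_lemma[OF sigma_algebra_Pow assms])
  then interpret sigma_algebra UNIV "lambda_system UNIV (Pow UNIV) \<mu>"
    by (simp add: measure_space_def)
  show "sets (carath_measure \<mu>) = lambda_system UNIV (Pow UNIV) \<mu>"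
    unfolding carath_measure_def by (rule sets_measure_of_eq)
  show "emeasure (carath_measure \<mu>) A = \<mu> A" if "A \<in> lambda_system UNIV (Pow UNIV) \<mu>"
    unfolding carath_measure_def
    using ms that by (intro emeasure_measure_of_sigma) (auto simp: measure_space_def)
qed

text \<open>
  Locally integrable means integrable in a neighbourhood of every point.  Functions are real-valued,
  gradients take values in \<open>[0, \<infinity>]\<close>, whence two versions.
\<close>

definition L1_loc :: "'a::metric_space measure \<Rightarrow> ('a \<Rightarrow> real) \<Rightarrow> bool" where
  "L1_loc M u \<longleftrightarrow>
     u \<in> borel_measurable M \<and> (\<forall>x. \<exists>r>0. set_integrable M (ball x r) u)"

definition L1_loc_ennreal :: "'a::metric_space measure \<Rightarrow> ('a \<Rightarrow> ennreal) \<Rightarrow> bool" where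
  "L1_loc_ennreal M g \<longleftrightarrow>
     g \<in> borel_measurable M \<and> (\<forall>x. \<exists>r>0. (\<integral>\<^sup>+y\<in>ball x r. g y \<partial>M) < \<infinity>)"

definition hajlasz_gradient ::
    "('a::metric_space set \<Rightarrow> ennreal) \<Rightarrow> ('a \<Rightarrow> ennreal) \<Rightarrow> ('a \<Rightarrow> real) \<Rightarrow> bool" where
  "hajlasz_gradient \<mu> g u \<longleftrightarrow>
     g \<in> borel_measurable (carath_measure \<mu>) \<and>
     (\<exists>E. \<mu> E = 0 \<and>
       (\<forall>x\<in>-E. \<forall>y\<in>-E. ennreal \<bar>u x - u y\<bar> \<le> ennreal (dist x y) * (g x + g y)))"

text \<open>The supremum ranges over all partitions \<open>a = t 0 \<le> \<dots> \<le> t n = b\<close>.\<close>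

definition curve_length :: "(real \<Rightarrow> 'a::metric_space) \<Rightarrow> real \<Rightarrow> real \<Rightarrow> ennreal" where
  "curve_length \<gamma> a b =
     (SUP (n, t) \<in> {(n::nat, t::nat \<Rightarrow> real). mono_on {0..n} t \<and> t 0 = a \<and> t n = b}.
        \<Sum>i<n. ennreal (dist (\<gamma> (t i)) (\<gamma> (t (Suc i)))))"

definition rectifiable_curve :: "(real \<Rightarrow> 'a::metric_space) \<Rightarrow> real \<Rightarrow> real \<Rightarrow> bool" where
  "rectifiable_curve \<gamma> a b \<longleftrightarrow>
     a \<le> b \<and> continuous_on {a..b} \<gamma> \<and> curve_length \<gamma> a b < \<infinity>"

text \<open>
  For a rectifiable curve and \<open>0 \<le> s \<le> length \<gamma>\<close> a parameter \<open>t\<close> as below exists, and \<open>\<gamma> t\<close> does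
  not depend on its choice, since \<open>\<gamma>\<close> is constant wherever its length function is constant.
\<close>

definition arclength_param ::
    "(real \<Rightarrow> 'a::metric_space) \<Rightarrow> real \<Rightarrow> real \<Rightarrow> real \<Rightarrow> 'a" where
  "arclength_param \<gamma> a b s = \<gamma> (SOME t. t \<in> {a..b} \<and> curve_length \<gamma> a t = ennreal s)"

definition curve_integral ::
    "(real \<Rightarrow> 'a::metric_space) \<Rightarrow> real \<Rightarrow> real \<Rightarrow> ('a \<Rightarrow> ennreal) \<Rightarrow> ennreal" where
  "curve_integral \<gamma> a b g =
     (\<integral>\<^sup>+s\<in>{0..enn2real (curve_length \<gamma> a b)}. g (arclength_param \<gamma> a b s) \<partial>lborel)"

definition upper_gradient :: "('a::metric_space \<Rightarrow> ennreal) \<Rightarrow> ('a \<Rightarrow> real) \<Rightarrow> bool" where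
  "upper_gradient g u \<longleftrightarrow>
     g \<in> borel_measurable borel \<and>
     (\<forall>\<gamma> a b. rectifiable_curve \<gamma> a b \<and> \<not> \<gamma> constant_on {a..b} \<longrightarrow>
        ennreal \<bar>u (\<gamma> a) - u (\<gamma> b)\<bar> \<le> curve_integral \<gamma> a b g)"

end

theory Submission
  imports Defs
begin

text \<open>
  Redefining \<open>g\<close> on a null set, we may assume that it is Borel and that the Hajlasz inequality holds
  at all points, with \<open>g = \<infinity>\<close> on the exceptional set.  Along an arc of length \<open>L\<close> parametrised by
  arc length whose ends lie in \<open>{g < \<infinity>}\<close>, chaining through points where \<open>g\<close> is at most its average
  over consecutive pieces of length \<open>L / n\<close>, and letting \<open>n \<rightarrow> \<infinity>\<close>, bounds the difference of \<open>u\<close> at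
  the ends by four times the integral of \<open>g\<close>.  So on \<open>{g < \<infinity>}\<close> the function \<open>u\<close> is 1-Lipschitz for
  the path pseudometric \<open>\<rho>\<close> with density \<open>4 g\<close>, and the McShane extension
  \<open>x \<mapsto> inf {u z + \<rho> x z | g z < \<infinity>}\<close> is a representative of \<open>u\<close> with upper gradient \<open>4 g\<close>: every
  nonconstant arc along which \<open>g\<close> is integrable meets \<open>{g < \<infinity>}\<close>.
\<close>

section \<open>The Hajlasz inequality on an interval\<close>

text \<open>If \<open>h\<close> exceeded its average \<open>m\<close> at every point, integrating
  over a set of positive measure would make the integral of \<open>h\<close> exceed itself. The
  product form also covers an infinite integral, where any point will do.\<close>

lemma exists_le_average:
  fixes h :: "real \<Rightarrow> ennreal"
  assumes [measurable]: "h \<in> borel_measurable borel" and "a < b"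
  shows "\<exists>s\<in>{a..<b}. ennreal (b - a) * h s \<le> (\<integral>\<^sup>+x\<in>{a..<b}. h x \<partial>lborel)"
proof (rule ccontr)
  define A where "A = (\<integral>\<^sup>+x\<in>{a..<b}. h x \<partial>lborel)"
  assume "\<not> ?thesis"
  then have A_less: "A < ennreal (b - a) * h s" if "s \<in> {a..<b}" for s
    using that by (auto simp: A_def not_le)
  define m where "m = A / ennreal (b - a)"
  have "A \<noteq> \<infinity>"
    using A_less[of a] \<open>a < b\<close> by force
  have pos: "ennreal (b - a) \<noteq> 0" "ennreal (b - a) \<noteq> \<infinity>"
    using \<open>a < b\<close> by auto
  have m_less: "m < h s" if "s \<in> {a..<b}" for s
    using A_less[OF that] pos unfolding m_def
    by (metis divide_less_ennreal ennreal_less_top infinity_ennreal_def mult.commute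
        not_gr_zero)
  have int_m: "(\<integral>\<^sup>+x\<in>{a..<b}. m \<partial>lborel) = A"
  proof -
    have "(\<integral>\<^sup>+x\<in>{a..<b}. m \<partial>lborel) = m * ennreal (b - a)"
      using \<open>a < b\<close> by (subst nn_integral_cmult_indicator) auto
    then show ?thesis
      using pos by (simp add: m_def ennreal_divide_times mult_divide_eq_ennreal)
  qed
  \<comment> \<open>Strict monotonicity of the integral needs that the reverse inequality fails on a
    non-null set; here it fails on all of \<open>{a..<b}\<close>.\<close>
  have "\<not> (AE x in lborel. h x * indicator {a..<b} x \<le> m * indicator {a..<b} x)"
  proof
    assume "AE x in lborel. h x * indicator {a..<b} x \<le> m * indicator {a..<b} x"
    then have "AE x in lborel. x \<notin> {a..<b}"
      by eventually_elim (use m_less in \<open>force simp: indicator_def split: if_splits\<close>)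
    then have "{a..<b} \<in> null_sets lborel"
      by (subst AE_iff_null_sets) auto
    then show False using \<open>a < b\<close> by (simp add: null_sets_def)
  qed
  then have "(\<integral>\<^sup>+x\<in>{a..<b}. m \<partial>lborel) < (\<integral>\<^sup>+x\<in>{a..<b}. h x \<partial>lborel)"
    using \<open>A \<noteq> \<infinity>\<close> int_m m_less
    by (intro nn_integral_less) (auto simp: indicator_def less_imp_le)
  then show False
    using int_m by (simp add: A_def)
qed

lemma ennreal_abs_diff_triangle:
  "ennreal \<bar>x - z\<bar> \<le> ennreal \<bar>x - y\<bar> + ennreal \<bar>y - z\<bar>" for x y z :: real
  by (simp flip: ennreal_plus)

lemma set_nn_integral_Ico_split:
  fixes h :: "real \<Rightarrow> ennreal"
  assumes [measurable]: "h \<in> borel_measurable borel" and "a \<le> b" "b \<le> c"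
  shows "(\<integral>\<^sup>+x\<in>{a..<c}. h x \<partial>lborel) =
    (\<integral>\<^sup>+x\<in>{a..<b}. h x \<partial>lborel) + (\<integral>\<^sup>+x\<in>{b..<c}. h x \<partial>lborel)"
  using assms by (subst nn_integral_disjoint_pair[symmetric]) (auto simp: ivl_disj_un)

lemma set_nn_integral_Icc_eq_Ico:
  fixes h :: "real \<Rightarrow> ennreal"
  shows "(\<integral>\<^sup>+x\<in>{a..b}. h x \<partial>lborel) = (\<integral>\<^sup>+x\<in>{a..<b}. h x \<partial>lborel)"
proof (rule nn_integral_cong_AE)
  have "AE x in lborel. x \<noteq> b" by (rule AE_lborel_singleton)
  then show "AE x in lborel. h x * indicator {a..b} x = h x * indicator {a..<b} x"
    by eventually_elim (auto simp: indicator_def)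
qed

text \<open>Cut the interval into \<open>n\<close> equal pieces and chain through points at which \<open>h\<close> does not
  exceed its average over the piece; consecutive points are at most two piece lengths apart.\<close>

lemma hajlasz_chain:
  fixes h :: "real \<Rightarrow> ennreal" and f :: "real \<Rightarrow> real"
  assumes h[measurable]: "h \<in> borel_measurable borel" and "p < q" and "n > 0"
    and H: "\<And>s t. s \<in> {p..q} \<Longrightarrow> t \<in> {p..q} \<Longrightarrow>
      ennreal \<bar>f s - f t\<bar> \<le> ennreal \<bar>s - t\<bar> * (h s + h t)"
  shows "ennreal \<bar>f p - f q\<bar> \<le>
    4 * (\<integral>\<^sup>+x\<in>{p..q}. h x \<partial>lborel) + ennreal ((q - p) / real n) * (h p + h q)"
proof -
  define \<delta> where "\<delta> = (q - p) / real n"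
  define I where "I a b = (\<integral>\<^sup>+x\<in>{a..<b}. h x \<partial>lborel)" for a b
  define P where "P k = p + real k * \<delta>" for k
  have "\<delta> > 0" using \<open>p < q\<close> \<open>n > 0\<close> by (simp add: \<delta>_def)
  have P0: "P 0 = p" and Pn: "P n = q" and PS: "P (Suc k) = P k + \<delta>" for k
    using \<open>n > 0\<close> by (auto simp: P_def \<delta>_def distrib_right add_divide_distrib)
  have P_mono: "P i \<le> P j" if "i \<le> j" for i j
    using that \<open>\<delta> > 0\<close> by (simp add: P_def mult_right_mono)
  have P_in: "P k \<in> {p..q}" if "k \<le> n" for k
    using P_mono[of 0 k] P_mono[of k n] that P0 Pn by simp
  have I_split: "I p (P (Suc k)) = I p (P k) + I (P k) (P (Suc k))" for k
    unfolding I_def using P_mono[of 0 k] P_mono[of k "Suc k"] P0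
    by (intro set_nn_integral_Ico_split) auto
  have avg: "\<exists>s\<in>{P k..<P (Suc k)}. ennreal \<delta> * h s \<le> I (P k) (P (Suc k))" for k
    using exists_le_average[OF h, of "P k" "P (Suc k)"] \<open>\<delta> > 0\<close> by (simp add: PS I_def)
  \<comment> \<open>Each finished piece has been charged at most \<open>2\<close> for the jump into
    it and \<open>2\<close> for the jump out of it, while the piece of \<open>s\<close> has so far
    received only its first \<open>2\<close>. The term with \<open>h p\<close> is the price of
    starting at \<open>p\<close>, which need not be a good point.\<close>
  have chain: "\<exists>s\<in>{P k..<P (Suc k)}. ennreal \<delta> * h s \<le> I (P k) (P (Suc k)) \<and>
    ennreal \<bar>f p - f s\<bar> \<le> ennreal \<delta> * h p + 4 * I p (P k) + 2 * I (P k) (P (Suc k))"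
    if "k < n" for k
    using that
  proof (induction k)
    case 0
    obtain s where s: "s \<in> {P 0..<P 1}" "ennreal \<delta> * h s \<le> I (P 0) (P 1)"
      using avg[of 0] by auto
    have "ennreal \<bar>f p - f s\<bar> \<le> ennreal \<bar>p - s\<bar> * (h p + h s)"
      using s P_in[of 0] P_in[of 1] 0 P0 by (intro H) auto
    also have "\<dots> \<le> ennreal \<delta> * (h p + h s)"
      using s P0 PS[of 0] by (intro mult_right_mono ennreal_leI) auto
    also have "\<dots> \<le> ennreal \<delta> * h p + I (P 0) (P 1)"
      using s by (simp add: distrib_left add_left_mono)
    also have "\<dots> \<le> ennreal \<delta> * h p + 4 * I p (P 0) + 2 * I (P 0) (P 1)"
      by (simp add: add_mono mult_2 add_increasing2)
    finally show ?case using s by auto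
  next
    case (Suc k)
    then obtain s where s: "s \<in> {P k..<P (Suc k)}" "ennreal \<delta> * h s \<le> I (P k) (P (Suc k))"
      "ennreal \<bar>f p - f s\<bar> \<le> ennreal \<delta> * h p + 4 * I p (P k) + 2 * I (P k) (P (Suc k))"
      by auto
    obtain t where t: "t \<in> {P (Suc k)..<P (Suc (Suc k))}"
      "ennreal \<delta> * h t \<le> I (P (Suc k)) (P (Suc (Suc k)))"
      using avg[of "Suc k"] by auto
    have in_pq: "s \<in> {p..q}" "t \<in> {p..q}"
      using s t P_in[of k] P_in[of "Suc k"] P_in[of "Suc (Suc k)"] Suc.prems by auto
    have "ennreal \<bar>f s - f t\<bar> \<le> ennreal \<bar>s - t\<bar> * (h s + h t)"
      using in_pq by (intro H)
    also have "\<dots> \<le> ennreal (2 * \<delta>) * (h s + h t)"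
      using s t PS[of k] PS[of "Suc k"] by (intro mult_right_mono ennreal_leI) auto
    also have "\<dots> = 2 * (ennreal \<delta> * h s) + 2 * (ennreal \<delta> * h t)"
      using \<open>\<delta> > 0\<close> by (simp add: ennreal_mult distrib_left mult.assoc)
    also have "\<dots> \<le> 2 * I (P k) (P (Suc k)) + 2 * I (P (Suc k)) (P (Suc (Suc k)))"
      using s t by (intro add_mono mult_left_mono) auto
    finally have st: "ennreal \<bar>f s - f t\<bar> \<le>
      2 * I (P k) (P (Suc k)) + 2 * I (P (Suc k)) (P (Suc (Suc k)))" .
    have "ennreal \<bar>f p - f t\<bar> \<le> ennreal \<bar>f p - f s\<bar> + ennreal \<bar>f s - f t\<bar>"
      by (rule ennreal_abs_diff_triangle)
    also have "\<dots> \<le> (ennreal \<delta> * h p + 4 * I p (P k) + 2 * I (P k) (P (Suc k))) +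
        (2 * I (P k) (P (Suc k)) + 2 * I (P (Suc k)) (P (Suc (Suc k))))"
      by (intro add_mono s st)
    also have "\<dots> = ennreal \<delta> * h p + 4 * I p (P (Suc k)) + 2 * I (P (Suc k)) (P (Suc (Suc k)))"
    proof -
      have "4 * I p (P (Suc k)) = 4 * I p (P k) + (2 * I (P k) (P (Suc k)) + 2 * I (P k) (P (Suc k)))"
        unfolding I_split by (simp add: distrib_left flip: distrib_right)
      then show ?thesis by (simp add: ac_simps)
    qed
    finally show ?case using t by auto
  qed
  obtain k where k: "n = Suc k" using \<open>n > 0\<close> by (cases n) auto
  obtain s where s: "s \<in> {P k..<P (Suc k)}" "ennreal \<delta> * h s \<le> I (P k) (P (Suc k))"
      "ennreal \<bar>f p - f s\<bar> \<le> ennreal \<delta> * h p + 4 * I p (P k) + 2 * I (P k) (P (Suc k))"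
    using chain[of k] k by auto
  \<comment> \<open>The end \<open>q\<close> need not be a good point either; the last jump spans at
    most one piece and leaves a term with \<open>h q\<close>.\<close>
  have "ennreal \<bar>f s - f q\<bar> \<le> ennreal \<bar>s - q\<bar> * (h s + h q)"
    using s P_in[of k] P_in[of n] k \<open>p < q\<close> by (intro H) auto
  also have "\<dots> \<le> ennreal \<delta> * (h s + h q)"
    using s Pn k PS[of k] by (intro mult_right_mono ennreal_leI) auto
  also have "\<dots> \<le> 2 * I (P k) (P (Suc k)) + ennreal \<delta> * h q"
    using s by (auto simp: distrib_left mult_2 intro!: add_mono intro: add_increasing2)
  finally have sq: "ennreal \<bar>f s - f q\<bar> \<le> 2 * I (P k) (P (Suc k)) + ennreal \<delta> * h q" .
  have "ennreal \<bar>f p - f q\<bar> \<le> ennreal \<bar>f p - f s\<bar> + ennreal \<bar>f s - f q\<bar>"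
    by (rule ennreal_abs_diff_triangle)
  also have "\<dots> \<le> (ennreal \<delta> * h p + 4 * I p (P k) + 2 * I (P k) (P (Suc k))) +
      (2 * I (P k) (P (Suc k)) + ennreal \<delta> * h q)"
    by (intro add_mono s sq)
  also have "\<dots> = 4 * I p (P (Suc k)) + ennreal \<delta> * (h p + h q)"
  proof -
    have "4 * I p (P (Suc k)) = 4 * I p (P k) + (2 * I (P k) (P (Suc k)) + 2 * I (P k) (P (Suc k)))"
      unfolding I_split by (simp add: distrib_left flip: distrib_right)
    then show ?thesis by (simp add: ac_simps distrib_left)
  qed
  also have "I p (P (Suc k)) = (\<integral>\<^sup>+x\<in>{p..q}. h x \<partial>lborel)"
    using Pn k by (simp add: I_def set_nn_integral_Icc_eq_Ico)
  finally show ?thesis by (simp add: \<delta>_def)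
qed

text \<open>Let the number of pieces tend to infinity: as \<open>h p\<close> and \<open>h q\<close>
  are finite, the boundary terms of the chain, which carry the length of one piece as a factor,
  vanish in the limit.\<close>

lemma hajlasz_interval:
  fixes h :: "real \<Rightarrow> ennreal" and f :: "real \<Rightarrow> real"
  assumes h: "h \<in> borel_measurable borel" and "p \<le> q"
    and H: "\<And>s t. s \<in> {p..q} \<Longrightarrow> t \<in> {p..q} \<Longrightarrow>
      ennreal \<bar>f s - f t\<bar> \<le> ennreal \<bar>s - t\<bar> * (h s + h t)"
    and fin: "h p < \<infinity>" "h q < \<infinity>"
  shows "ennreal \<bar>f p - f q\<bar> \<le> 4 * (\<integral>\<^sup>+x\<in>{p..q}. h x \<partial>lborel)"
proof (cases "p = q")
  case False
  define C where "C = enn2real (h p + h q)"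
  have C: "h p + h q = ennreal C" "C \<ge> 0"
    using fin by (auto simp: C_def)
  have "(\<lambda>n. (q - p) / real (Suc n) * C) \<longlonglongrightarrow> 0"
    by (intro tendsto_mult_left_zero LIMSEQ_Suc tendsto_divide_0[OF tendsto_const]
      filterlim_at_top_imp_at_infinity filterlim_real_sequentially)
  then have "(\<lambda>n. ennreal ((q - p) / real (Suc n) * C)) \<longlonglongrightarrow> 0"
    using tendsto_ennrealI by fastforce
  then have lim: "(\<lambda>n. 4 * (\<integral>\<^sup>+x\<in>{p..q}. h x \<partial>lborel) + ennreal ((q - p) / real (Suc n) * C))
    \<longlonglongrightarrow> 4 * (\<integral>\<^sup>+x\<in>{p..q}. h x \<partial>lborel) + 0"
    by (intro tendsto_add tendsto_const)
  have "ennreal \<bar>f p - f q\<bar> \<le>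
    4 * (\<integral>\<^sup>+x\<in>{p..q}. h x \<partial>lborel) + ennreal ((q - p) / real (Suc n) * C)" for n
    using hajlasz_chain[of h p q "Suc n" f] h H False \<open>p \<le> q\<close> C
    by (simp add: ennreal_mult del: of_nat_Suc times_divide_eq_left)
  then show ?thesis
    using LIMSEQ_le_const[OF lim] by auto
qed simp

section \<open>Arc length\<close>

lemma curve_length_le_iff:
  "curve_length \<gamma> a b \<le> C \<longleftrightarrow> (\<forall>n t. mono_on {0..n} t \<longrightarrow> t 0 = a \<longrightarrow> t n = b \<longrightarrow>
     (\<Sum>i<n. ennreal (dist (\<gamma> (t i)) (\<gamma> (t (Suc i))))) \<le> C)"
  unfolding curve_length_def by (auto simp: SUP_le_iff)

lemma sum_le_curve_length:
  assumes "mono_on {0..n} t" "t 0 = a" "t n = b"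
  shows "(\<Sum>i<n. ennreal (dist (\<gamma> (t i)) (\<gamma> (t (Suc i))))) \<le> curve_length \<gamma> a b"
  using curve_length_le_iff[of \<gamma> a b "curve_length \<gamma> a b"] assms by auto

lemma dist_le_curve_length:
  assumes "a \<le> b"
  shows "ennreal (dist (\<gamma> a) (\<gamma> b)) \<le> curve_length \<gamma> a b"
  using sum_le_curve_length[of 1 "\<lambda>i. if i = 0 then a else b" a b \<gamma>] assms
  by (simp add: mono_on_def)

lemma curve_length_refl [simp]: "curve_length \<gamma> a a = 0"
proof -
  have "curve_length \<gamma> a a \<le> 0"
    unfolding curve_length_le_iff
  proof (intro allI impI)
    fix n :: nat and t :: "nat \<Rightarrow> real"
    assume t: "mono_on {0..n} t" "t 0 = a" "t n = a"
    have "t i = a" if "i \<le> n" for i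
      using monotone_onD[OF t(1), of 0 i] monotone_onD[OF t(1), of i n] that t by auto
    then show "(\<Sum>i<n. ennreal (dist (\<gamma> (t i)) (\<gamma> (t (Suc i))))) \<le> 0"
      by simp
  qed
  then show ?thesis by simp
qed

text \<open>Clipping a partition of \<open>[a, c]\<close> at \<open>b\<close> from above and from
  below gives partitions of both halves, and only the step across \<open>b\<close> costs a triangle
  inequality. Conversely, partitions of the halves concatenate.\<close>

lemma curve_length_add:
  assumes "a \<le> b" "b \<le> c"
  shows "curve_length \<gamma> a c = curve_length \<gamma> a b + curve_length \<gamma> b c"
proof (rule antisym)
  show "curve_length \<gamma> a c \<le> curve_length \<gamma> a b + curve_length \<gamma> b c"
    unfolding curve_length_le_iff
  proof (intro allI impI)
    fix n :: nat and t :: "nat \<Rightarrow> real"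
    assume t: "mono_on {0..n} t" "t 0 = a" "t n = c"
    define l where "l i = min (t i) b" for i
    define r where "r i = max (t i) b" for i
    have "(\<Sum>i<n. ennreal (dist (\<gamma> (t i)) (\<gamma> (t (Suc i))))) \<le>
      (\<Sum>i<n. ennreal (dist (\<gamma> (l i)) (\<gamma> (l (Suc i)))) + ennreal (dist (\<gamma> (r i)) (\<gamma> (r (Suc i)))))"
    proof (rule sum_mono)
      fix i assume "i \<in> {..<n}"
      then have "t i \<le> t (Suc i)"
        using monotone_onD[OF t(1), of i "Suc i"] by auto
      then show "ennreal (dist (\<gamma> (t i)) (\<gamma> (t (Suc i)))) \<le>
        ennreal (dist (\<gamma> (l i)) (\<gamma> (l (Suc i)))) + ennreal (dist (\<gamma> (r i)) (\<gamma> (r (Suc i))))"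
        by (auto simp: l_def r_def min_def max_def dist_triangle simp flip: ennreal_plus
            intro!: ennreal_leI)
    qed
    also have "\<dots> = (\<Sum>i<n. ennreal (dist (\<gamma> (l i)) (\<gamma> (l (Suc i))))) +
        (\<Sum>i<n. ennreal (dist (\<gamma> (r i)) (\<gamma> (r (Suc i)))))"
      by (rule sum.distrib)
    also have "\<dots> \<le> curve_length \<gamma> a b + curve_length \<gamma> b c"
      using t assms unfolding mono_on_def l_def r_def
      by (intro add_mono sum_le_curve_length) (auto simp: mono_on_def min_def max_def intro: order_trans)
    finally show "(\<Sum>i<n. ennreal (dist (\<gamma> (t i)) (\<gamma> (t (Suc i))))) \<le>
      curve_length \<gamma> a b + curve_length \<gamma> b c" .
  qed
next
  define T where "T a b = {(n::nat, t::nat \<Rightarrow> real). mono_on {0..n} t \<and> t 0 = a \<and> t n = b}" for a b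
  define S where "S = (\<lambda>(n::nat, t::nat \<Rightarrow> real). \<Sum>i<n. ennreal (dist (\<gamma> (t i)) (\<gamma> (t (Suc i)))))"
  have len: "curve_length \<gamma> a b = (SUP p\<in>T a b. S p)" for a b
    by (simp add: curve_length_def T_def S_def)
  have ne: "T a b \<noteq> {}" if "a \<le> b" for a b
  proof -
    have "(1, \<lambda>i. if i = 0 then a else b) \<in> T a b"
      using that by (auto simp: T_def mono_on_def)
    then show ?thesis by blast
  qed
  have "S p + S q \<le> curve_length \<gamma> a c" if "p \<in> T a b" "q \<in> T b c" for p q
  proof -
    obtain n t m s where pq: "p = (n, t)" "q = (m, s)"
      by (metis prod.exhaust)
    have t: "mono_on {0..n} t" "t 0 = a" "t n = b" and s: "mono_on {0..m} s" "s 0 = b" "s m = c"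
      using that by (auto simp: T_def pq)
    \<comment> \<open>Index \<open>n\<close> is shared, since \<open>t n = b = s 0\<close>; hence
      there are \<open>n + m\<close> steps and no extra one at the joint.\<close>
    define w where "w i = (if i \<le> n then t i else s (i - n))" for i
    have w_add: "w (n + i) = s i" for i
      using s t by (auto simp: w_def)
    have mono: "w i \<le> w j" if "i \<le> j" "j \<le> n + m" for i j
    proof -
      have "t i \<le> t n" if "i \<le> n" for i
        using monotone_onD[OF t(1), of i n] that by auto
      moreover have "s 0 \<le> s i" if "i \<le> m" for i
        using monotone_onD[OF s(1), of 0 i] that by auto
      moreover have "t i \<le> t j" if "j \<le> n"
        using monotone_onD[OF t(1), of i j] that \<open>i \<le> j\<close> by auto
      moreover have "s (i - n) \<le> s (j - n)"
        using monotone_onD[OF s(1), of "i - n" "j - n"] that \<open>i \<le> j\<close> by auto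
      ultimately show ?thesis
        using that t s order_trans[of "t i" b "s (j - n)"] by (auto simp: w_def not_le)
    qed
    have "S p + S q = (\<Sum>i<n. ennreal (dist (\<gamma> (w i)) (\<gamma> (w (Suc i))))) +
        (\<Sum>i<m. ennreal (dist (\<gamma> (w (n + i))) (\<gamma> (w (n + Suc i)))))"
      unfolding w_add by (simp add: S_def pq w_def)
    also have "\<dots> = (\<Sum>i<n + m. ennreal (dist (\<gamma> (w i)) (\<gamma> (w (Suc i)))))"
      by (induction m) (simp_all add: ac_simps)
    also have "\<dots> \<le> curve_length \<gamma> a c"
      using mono w_add[of 0] w_add[of m] s t
      by (intro sum_le_curve_length) (auto simp: mono_on_def w_def)
    finally show ?thesis .
  qed
  \<comment> \<open>The suprema are taken one at a time; adding a constant commutes with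
    \<open>SUP\<close> over a nonempty set.\<close>
  then have "(SUP p\<in>T a b. S p + (SUP q\<in>T b c. S q)) \<le> curve_length \<gamma> a c"
    using ne[OF \<open>b \<le> c\<close>] by (auto simp: ennreal_SUP_add_right intro!: SUP_least)
  then show "curve_length \<gamma> a b + curve_length \<gamma> b c \<le> curve_length \<gamma> a c"
    using ne[OF \<open>a \<le> b\<close>] by (simp add: len ennreal_SUP_add_left)
qed

text \<open>The length is a supremum of functions that are continuous in either endpoint, hence lower
  semicontinuous.\<close>

lemma curve_length_le_left_limit:
  assumes cont: "continuous_on {a..b} \<gamma>" and "a < b"
    and le: "\<And>x. a \<le> x \<Longrightarrow> x < b \<Longrightarrow> curve_length \<gamma> a x \<le> C"
  shows "curve_length \<gamma> a b \<le> C"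
  unfolding curve_length_le_iff
proof (intro allI impI)
  fix n :: nat and t :: "nat \<Rightarrow> real"
  assume t: "mono_on {0..n} t" "t 0 = a" "t n = b"
  have t_in: "t i \<in> {a..b}" if "i \<le> n" for i
    using monotone_onD[OF t(1), of 0 i] monotone_onD[OF t(1), of i n] that t by auto
  \<comment> \<open>Clipping the partition at \<open>x < b\<close> gives a partition of
    \<open>[a, x]\<close>, whose sum is at most \<open>C\<close> and tends to the original sum as
    \<open>x\<close> tends to \<open>b\<close>.\<close>
  have lim: "((\<lambda>x. \<gamma> (min (t i) x)) \<longlongrightarrow> \<gamma> (t i)) (at b within {a..<b})" if "i \<le> n" for i
  proof -
    have "continuous_on {a..b} (\<lambda>x. \<gamma> (min (t i) x))"
      using t_in[OF that] by (intro continuous_on_compose2[OF cont] continuous_intros) auto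
    then have "((\<lambda>x. \<gamma> (min (t i) x)) \<longlongrightarrow> \<gamma> (min (t i) b)) (at b within {a..b})"
      using \<open>a < b\<close> by (auto simp: continuous_on_def)
    then show ?thesis
      using t_in[OF that] by (auto elim!: tendsto_within_subset)
  qed
  have "((\<lambda>x. \<Sum>i<n. ennreal (dist (\<gamma> (min (t i) x)) (\<gamma> (min (t (Suc i)) x))))
      \<longlongrightarrow> (\<Sum>i<n. ennreal (dist (\<gamma> (t i)) (\<gamma> (t (Suc i)))))) (at b within {a..<b})"
    by (intro tendsto_sum tendsto_ennrealI tendsto_dist lim) auto
  moreover have "eventually (\<lambda>x. (\<Sum>i<n. ennreal (dist (\<gamma> (min (t i) x)) (\<gamma> (min (t (Suc i)) x))))
      \<le> C) (at b within {a..<b})"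
    unfolding eventually_at_filter
  proof (intro always_eventually allI impI)
    fix x assume "x \<in> {a..<b}"
    then show "(\<Sum>i<n. ennreal (dist (\<gamma> (min (t i) x)) (\<gamma> (min (t (Suc i)) x)))) \<le> C"
      using t by (intro order_trans[OF sum_le_curve_length le[of x]])
        (auto simp: mono_on_def min_def intro: order_trans)
  qed
  moreover have "at b within {a..<b} \<noteq> bot"
    using \<open>a < b\<close> by (simp add: trivial_limit_within islimpt_Ico)
  ultimately show "(\<Sum>i<n. ennreal (dist (\<gamma> (t i)) (\<gamma> (t (Suc i))))) \<le> C"
    by (rule tendsto_upperbound)
qed

lemma curve_length_le_right_limit:
  assumes cont: "continuous_on {a..b} \<gamma>" and "a < b"
    and le: "\<And>x. a < x \<Longrightarrow> x \<le> b \<Longrightarrow> curve_length \<gamma> x b \<le> C"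
  shows "curve_length \<gamma> a b \<le> C"
  unfolding curve_length_le_iff
proof (intro allI impI)
  fix n :: nat and t :: "nat \<Rightarrow> real"
  assume t: "mono_on {0..n} t" "t 0 = a" "t n = b"
  have t_in: "t i \<in> {a..b}" if "i \<le> n" for i
    using monotone_onD[OF t(1), of 0 i] monotone_onD[OF t(1), of i n] that t by auto
  have lim: "((\<lambda>x. \<gamma> (max (t i) x)) \<longlongrightarrow> \<gamma> (t i)) (at a within {a<..b})" if "i \<le> n" for i
  proof -
    have "continuous_on {a..b} (\<lambda>x. \<gamma> (max (t i) x))"
      using t_in[OF that] by (intro continuous_on_compose2[OF cont] continuous_intros) auto
    then have "((\<lambda>x. \<gamma> (max (t i) x)) \<longlongrightarrow> \<gamma> (max (t i) a)) (at a within {a..b})"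
      using \<open>a < b\<close> by (auto simp: continuous_on_def)
    then show ?thesis
      using t_in[OF that] by (auto elim!: tendsto_within_subset)
  qed
  have "((\<lambda>x. \<Sum>i<n. ennreal (dist (\<gamma> (max (t i) x)) (\<gamma> (max (t (Suc i)) x))))
      \<longlongrightarrow> (\<Sum>i<n. ennreal (dist (\<gamma> (t i)) (\<gamma> (t (Suc i)))))) (at a within {a<..b})"
    by (intro tendsto_sum tendsto_ennrealI tendsto_dist lim) auto
  moreover have "eventually (\<lambda>x. (\<Sum>i<n. ennreal (dist (\<gamma> (max (t i) x)) (\<gamma> (max (t (Suc i)) x))))
      \<le> C) (at a within {a<..b})"
    unfolding eventually_at_filter
  proof (intro always_eventually allI impI)
    fix x assume "x \<in> {a<..b}"
    then show "(\<Sum>i<n. ennreal (dist (\<gamma> (max (t i) x)) (\<gamma> (max (t (Suc i)) x)))) \<le> C"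
      using t by (intro order_trans[OF sum_le_curve_length le[of x]])
        (auto simp: mono_on_def max_def intro: order_trans)
  qed
  moreover have "at a within {a<..b} \<noteq> bot"
    using \<open>a < b\<close> by (simp add: trivial_limit_within islimpt_Ioc)
  ultimately show "(\<Sum>i<n. ennreal (dist (\<gamma> (t i)) (\<gamma> (t (Suc i))))) \<le> C"
    by (rule tendsto_upperbound)
qed

lemma ennreal_le_diff_of_sum:
  "s \<le> v \<Longrightarrow> v + w = l \<Longrightarrow> w \<le> l - s" for s v w l :: ennreal
  by (metis add.commute add_left_mono ennreal_le_minus_iff order.trans ennreal_minus_mono le_iff_add)

text \<open>Here \<open>l\<close>, \<open>v\<close>, \<open>w\<close> stand for the lengths of a
  curve and of its two parts. Subtraction truncates at zero, so a bound on \<open>w\<close> is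
  turned back into one on \<open>v\<close> by means of \<open>s \<le> l\<close> and the finiteness
  of \<open>l\<close>.\<close>

lemma ennreal_ge_of_sum:
  "v + w = l \<Longrightarrow> w \<le> l - s \<Longrightarrow> s \<le> l \<Longrightarrow> l < \<infinity> \<Longrightarrow> s \<le> v" for s v w l :: ennreal
  by (cases s; cases v; cases w; cases l)
    (auto simp: ennreal_minus ennreal_le_iff2 simp flip: ennreal_plus)

text \<open>An intermediate value argument at the supremum \<open>t\<close> of the parameters with
  initial length at most \<open>s\<close>. Semicontinuity from the left bounds the length up to
  \<open>t\<close> by \<open>s\<close>; semicontinuity of the remaining length from the right, with
  additivity and finiteness, gives the reverse.\<close>

lemma curve_length_attains:
  assumes "rectifiable_curve \<gamma> a b" and s: "0 \<le> s" "ennreal s \<le> curve_length \<gamma> a b"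
  shows "\<exists>t\<in>{a..b}. curve_length \<gamma> a t = ennreal s"
proof -
  have "a \<le> b" and cont: "continuous_on {a..b} \<gamma>" and fin: "curve_length \<gamma> a b < \<infinity>"
    using assms by (auto simp: rectifiable_curve_def)
  define T where "T = {t\<in>{a..b}. curve_length \<gamma> a t \<le> ennreal s}"
  define t where "t = Sup T"
  have "a \<in> T" using \<open>a \<le> b\<close> by (simp add: T_def)
  have bdd: "bdd_above T" by (auto simp: T_def bdd_above_def)
  have "a \<le> t" using \<open>a \<in> T\<close> bdd by (simp add: t_def cSup_upper)
  have "t \<le> b" using \<open>a \<in> T\<close> by (auto simp: t_def T_def intro!: cSup_least)
  have below: "curve_length \<gamma> a x \<le> ennreal s" if "a \<le> x" "x < t" for x
  proof -
    obtain y where "y \<in> T" "x < y"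
      using \<open>x < t\<close> less_cSupD[of T x] \<open>a \<in> T\<close> unfolding t_def by blast
    then show ?thesis
      using curve_length_add[of a x y \<gamma>] that by (auto simp: T_def intro: order_trans[rotated])
  qed
  have le: "curve_length \<gamma> a t \<le> ennreal s"
  proof (cases "a = t")
    case True
    then show ?thesis by simp
  next
    case False
    show ?thesis
    proof (rule curve_length_le_left_limit[OF _ _ below])
      show "continuous_on {a..t} \<gamma>"
        using \<open>t \<le> b\<close> by (intro continuous_on_subset[OF cont]) auto
    qed (use False \<open>a \<le> t\<close> in auto)
  qed
  have "ennreal s \<le> curve_length \<gamma> a t"
  proof (cases "t = b")
    case False
    have split: "curve_length \<gamma> a x + curve_length \<gamma> x b = curve_length \<gamma> a b"
      if "a \<le> x" "x \<le> b" for x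
      using curve_length_add[OF that, of \<gamma>] by simp
    \<comment> \<open>Parameters beyond \<open>t\<close> lie outside \<open>T\<close>, so the length
      still to come after them is at most the total minus \<open>s\<close>; this survives the limit
      down to \<open>t\<close>.\<close>
    have "curve_length \<gamma> t b \<le> curve_length \<gamma> a b - ennreal s"
    proof (rule curve_length_le_right_limit[OF continuous_on_subset[OF cont]])
      fix x assume x: "t < x" "x \<le> b"
      then have "x \<notin> T" using bdd cSup_upper[of x T] by (auto simp: t_def)
      then have "ennreal s \<le> curve_length \<gamma> a x"
        using x \<open>a \<le> t\<close> by (auto simp: T_def)
      then show "curve_length \<gamma> x b \<le> curve_length \<gamma> a b - ennreal s"
        by (rule ennreal_le_diff_of_sum) (use x \<open>a \<le> t\<close> in \<open>intro split; simp\<close>)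
    qed (use \<open>a \<le> t\<close> \<open>t \<le> b\<close> False in auto)
    then show ?thesis
      by (rule ennreal_ge_of_sum[OF split[OF \<open>a \<le> t\<close> \<open>t \<le> b\<close>] _ s(2) fin])
  qed (use s in simp)
  with le show ?thesis using \<open>a \<le> t\<close> \<open>t \<le> b\<close> by (intro bexI[of _ t]) auto
qed

section \<open>Parametrisation by arc length\<close>

lemma arclength_param_attained:
  assumes "rectifiable_curve \<gamma> a b" and s: "s \<in> {0..enn2real (curve_length \<gamma> a b)}"
  obtains t where "t \<in> {a..b}" "curve_length \<gamma> a t = ennreal s" "arclength_param \<gamma> a b s = \<gamma> t"
proof -
  have "ennreal s \<le> curve_length \<gamma> a b"
    using assms by (auto simp: rectifiable_curve_def dest!: ennreal_leI)
  then have "\<exists>t. t \<in> {a..b} \<and> curve_length \<gamma> a t = ennreal s"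
    using curve_length_attains[OF assms(1), of s] s by auto
  from someI_ex[OF this] that show ?thesis
    by (auto simp: arclength_param_def)
qed

text \<open>The chord is no longer than the piece of curve, whose length is \<open>s' - s\<close> by
  additivity. With \<open>s = s'\<close> it shows that the choice made by \<open>SOME\<close> in
  \<open>arclength_param\<close> does not affect the point.\<close>

lemma dist_le_curve_length_diff:
  assumes "a \<le> t" "t \<le> t'" "curve_length \<gamma> a t = ennreal s" "curve_length \<gamma> a t' = ennreal s'"
    "0 \<le> s" "0 \<le> s'"
  shows "dist (\<gamma> t) (\<gamma> t') \<le> s' - s"
proof -
  have "ennreal (s + dist (\<gamma> t) (\<gamma> t')) \<le> ennreal s'"
    using curve_length_add[of a t t' \<gamma>] dist_le_curve_length[of t t' \<gamma>] assms
    by (simp add: add_left_mono)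
  then show ?thesis using assms by (subst (asm) ennreal_le_iff) auto
qed

lemma arclength_param_lipschitz:
  assumes "rectifiable_curve \<gamma> a b" and s: "s \<in> {0..enn2real (curve_length \<gamma> a b)}"
    and s': "s' \<in> {0..enn2real (curve_length \<gamma> a b)}"
  shows "dist (arclength_param \<gamma> a b s) (arclength_param \<gamma> a b s') \<le> \<bar>s - s'\<bar>"
proof -
  obtain t where t: "t \<in> {a..b}" "curve_length \<gamma> a t = ennreal s" "arclength_param \<gamma> a b s = \<gamma> t"
    using arclength_param_attained[OF assms(1) s] .
  obtain t' where t': "t' \<in> {a..b}" "curve_length \<gamma> a t' = ennreal s'"
    "arclength_param \<gamma> a b s' = \<gamma> t'"
    using arclength_param_attained[OF assms(1) s'] .
  show ?thesis
    using dist_le_curve_length_diff[of a t t' \<gamma> s s'] dist_le_curve_length_diff[of a t' t \<gamma> s' s]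
      t t' s s' by (cases "t \<le> t'") (auto simp: dist_commute)
qed

text \<open>The parameters chosen for length zero and for the full length need not be
  \<open>a\<close> and \<open>b\<close>, but the curve has zero length in between, so the points
  agree.\<close>

lemma arclength_param_endpoints:
  assumes \<gamma>: "rectifiable_curve \<gamma> a b"
  shows "arclength_param \<gamma> a b 0 = \<gamma> a"
    and "arclength_param \<gamma> a b (enn2real (curve_length \<gamma> a b)) = \<gamma> b"
proof -
  have ab: "a \<le> b" "ennreal (enn2real (curve_length \<gamma> a b)) = curve_length \<gamma> a b"
    using \<gamma> by (auto simp: rectifiable_curve_def)
  obtain t where "t \<in> {a..b}" "curve_length \<gamma> a t = ennreal 0" "arclength_param \<gamma> a b 0 = \<gamma> t"
    by (rule arclength_param_attained[OF \<gamma>, of 0]) auto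
  then show "arclength_param \<gamma> a b 0 = \<gamma> a"
    using dist_le_curve_length_diff[of a a t \<gamma> 0 0] by auto
  obtain t where "t \<in> {a..b}" "curve_length \<gamma> a t = ennreal (enn2real (curve_length \<gamma> a b))"
    "arclength_param \<gamma> a b (enn2real (curve_length \<gamma> a b)) = \<gamma> t"
    by (rule arclength_param_attained[OF \<gamma>, of "enn2real (curve_length \<gamma> a b)"]) auto
  then show "arclength_param \<gamma> a b (enn2real (curve_length \<gamma> a b)) = \<gamma> b"
    using dist_le_curve_length_diff[of a t b \<gamma> "enn2real (curve_length \<gamma> a b)"
        "enn2real (curve_length \<gamma> a b)"] ab by auto
qed

section \<open>The path pseudometric and McShane extension\<close>

text \<open>Witnesses that the path pseudometric with density \<open>4 h\<close> is at most
  \<open>r\<close>; as a relation it needs no value for infinite distances. Curves are 1-Lipschitz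
  on the whole line, which keeps \<open>h\<close> along them Borel and allows cutting, reversing and
  gluing.\<close>

definition arc_cost_le :: "('a::metric_space \<Rightarrow> ennreal) \<Rightarrow> real \<Rightarrow> 'a \<Rightarrow> 'a \<Rightarrow> bool" where
  "arc_cost_le h r x y \<longleftrightarrow> 0 \<le> r \<and> (\<exists>(c::real \<Rightarrow> 'a) p q. p \<le> q \<and> 1-lipschitz_on UNIV c \<and> c p = x \<and> c q = y \<and>
     4 * (\<integral>\<^sup>+s\<in>{p..q}. h (c s) \<partial>lborel) \<le> ennreal r)"

lemma arc_cost_leI:
  fixes c :: "real \<Rightarrow> 'a::metric_space"
  assumes "0 \<le> r" "p \<le> q" "1-lipschitz_on UNIV c" "c p = x" "c q = y"
    "4 * (\<integral>\<^sup>+s\<in>{p..q}. h (c s) \<partial>lborel) \<le> ennreal r"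
  shows "arc_cost_le h r x y"
  using assms unfolding arc_cost_le_def by blast

lemma arc_cost_leE:
  fixes h :: "'a::metric_space \<Rightarrow> ennreal"
  assumes "arc_cost_le h r x y"
  obtains c :: "real \<Rightarrow> 'a" and p q where "0 \<le> r" "p \<le> q" "1-lipschitz_on UNIV c"
    "c p = x" "c q = y" "4 * (\<integral>\<^sup>+s\<in>{p..q}. h (c s) \<partial>lborel) \<le> ennreal r"
  using assms unfolding arc_cost_le_def by blast

lemma borel_measurable_lipschitz_comp:
  fixes c :: "real \<Rightarrow> 'a::metric_space" and h :: "'a \<Rightarrow> ennreal"
  assumes "h \<in> borel_measurable borel" "C-lipschitz_on UNIV c"
  shows "(\<lambda>s. h (c s)) \<in> borel_measurable borel"
  by (rule measurable_compose[OF borel_measurable_continuous_onI assms(1)])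
    (rule lipschitz_on_continuous_on[OF assms(2)])

lemma arc_cost_le_refl: "arc_cost_le h 0 x x"
proof (rule arc_cost_leI[of _ 0 0 "\<lambda>_. x"])
  show "1-lipschitz_on UNIV (\<lambda>_::real. x)"
    by (rule lipschitz_onI) auto
  \<comment> \<open>A single parameter is null, so the cost is zero even if
    \<open>h x = \<infinity>\<close>.\<close>
  have "AE s in lborel. s \<noteq> (0::real)" by (rule AE_lborel_singleton)
  then have "(\<integral>\<^sup>+s\<in>{0..0::real}. h x \<partial>lborel) = (\<integral>\<^sup>+(s::real). 0 \<partial>lborel)"
    by (intro nn_integral_cong_AE, eventually_elim) (simp add: indicator_def)
  then show "4 * (\<integral>\<^sup>+s\<in>{0..0::real}. h x \<partial>lborel) \<le> ennreal 0"
    by simp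
qed auto

lemma arc_cost_le_sym:
  fixes h :: "'a::metric_space \<Rightarrow> ennreal"
  assumes h: "h \<in> borel_measurable borel" and "arc_cost_le h r x y"
  shows "arc_cost_le h r y x"
proof -
  obtain c :: "real \<Rightarrow> 'a" and p q where c: "0 \<le> r" "p \<le> q" "1-lipschitz_on UNIV c" "c p = x" "c q = y"
    "4 * (\<integral>\<^sup>+s\<in>{p..q}. h (c s) \<partial>lborel) \<le> ennreal r"
    using assms(2) by (rule arc_cost_leE)
  note [measurable] = borel_measurable_lipschitz_comp[OF h c(3)]
  have "(\<integral>\<^sup>+s\<in>{p..q}. h (c s) \<partial>lborel) =
      (\<integral>\<^sup>+s. h (c (- s)) * indicator {p..q} (- s) \<partial>lborel)"
    by (subst nn_integral_real_affine[where c = "-1" and t = 0]) auto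
  also have "\<dots> = (\<integral>\<^sup>+s\<in>{-q..-p}. h (c (- s)) \<partial>lborel)"
    by (intro nn_integral_cong) (auto simp: indicator_def)
  finally have int: "(\<integral>\<^sup>+s\<in>{p..q}. h (c s) \<partial>lborel) = (\<integral>\<^sup>+s\<in>{-q..-p}. h (c (- s)) \<partial>lborel)" .
  have "1-lipschitz_on UNIV (\<lambda>s. c (- s))"
    using lipschitz_onD[OF c(3), of "- s" "- t" for s t]
    by (intro lipschitz_onI) (auto simp: dist_real_def abs_minus_commute)
  then show ?thesis
    using c by (intro arc_cost_leI[of _ "-q" "-p" "\<lambda>s. c (- s)"]) (simp_all add: int)
qed

lemma arc_cost_le_trans:
  fixes h :: "'a::metric_space \<Rightarrow> ennreal"
  assumes h: "h \<in> borel_measurable borel"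
    and "arc_cost_le h r x y" "arc_cost_le h r' y z"
  shows "arc_cost_le h (r + r') x z"
proof -
  obtain c :: "real \<Rightarrow> 'a" and p q where c: "0 \<le> r" "p \<le> q" "1-lipschitz_on UNIV c" "c p = x" "c q = y"
    "4 * (\<integral>\<^sup>+s\<in>{p..q}. h (c s) \<partial>lborel) \<le> ennreal r"
    using assms(2) by (rule arc_cost_leE)
  obtain c' :: "real \<Rightarrow> 'a" and p' q' where c': "0 \<le> r'" "p' \<le> q'" "1-lipschitz_on UNIV c'" "c' p' = y" "c' q' = z"
    "4 * (\<integral>\<^sup>+s\<in>{p'..q'}. h (c' s) \<partial>lborel) \<le> ennreal r'"
    using assms(3) by (rule arc_cost_leE)
  \<comment> \<open>The second curve is shifted to start at parameter \<open>q\<close>, where both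
    formulas give \<open>y\<close>.\<close>
  define e where "e s = (if s \<le> q then c s else c' (s - q + p'))" for s
  have e_right: "e s = c' (s - q + p')" if "q \<le> s" for s
    using that c c' by (auto simp: e_def)
  have lip: "dist (c s) (c t) \<le> \<bar>s - t\<bar>" "dist (c' s) (c' t) \<le> \<bar>s - t\<bar>" for s t
    using lipschitz_onD[OF c(3), of s t] lipschitz_onD[OF c'(3), of s t]
    by (auto simp: dist_real_def)
  have e_lip: "dist (e s) (e t) \<le> t - s" if "s \<le> t" for s t
  proof -
    consider "t \<le> q" | "q \<le> s" | "s < q" "q < t" by linarith
    then show ?thesis
    proof cases
      \<comment> \<open>Only an interval across \<open>q\<close> mixes the two formulas; the
        triangle inequality through \<open>e q\<close> keeps the Lipschitz constant 1.\<close>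
      case 3
      have "dist (e s) (e t) \<le> dist (e s) (e q) + dist (e q) (e t)"
        by (rule dist_triangle)
      also have "\<dots> \<le> (q - s) + (t - q)"
        using lip(1)[of s q] lip(2)[of p' "t - q + p'"] 3 e_right[of q] e_right[of t]
        by (intro add_mono) (auto simp: e_def)
      finally show ?thesis by simp
    next
      case 1
      then show ?thesis using lip(1)[of s t] that by (simp add: e_def)
    next
      case 2
      then show ?thesis
        using lip(2)[of "s - q + p'" "t - q + p'"] that by (simp add: e_right)
    qed
  qed
  have lip_e: "1-lipschitz_on UNIV e"
  proof (rule lipschitz_onI)
    fix s t
    show "dist (e s) (e t) \<le> 1 * dist s t"
      using e_lip[of s t] e_lip[of t s]
      by (cases "s \<le> t") (auto simp: dist_real_def dist_commute)
  qed simp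
  note [measurable] = borel_measurable_lipschitz_comp[OF h c'(3)]
    borel_measurable_lipschitz_comp[OF h lip_e]
  define w where "w = q + (q' - p')"
  have w: "q \<le> w" using c' by (simp add: w_def)
  have left: "(\<integral>\<^sup>+s\<in>{p..<q}. h (e s) \<partial>lborel) = (\<integral>\<^sup>+s\<in>{p..q}. h (c s) \<partial>lborel)"
    unfolding set_nn_integral_Icc_eq_Ico
    by (intro nn_integral_cong) (auto simp: e_def indicator_def)
  have "(\<integral>\<^sup>+s\<in>{q..w}. h (e s) \<partial>lborel) =
      (\<integral>\<^sup>+s. h (e (q - p' + s)) * indicator {q..w} (q - p' + s) \<partial>lborel)"
    by (subst nn_integral_real_affine[where c = 1 and t = "q - p'"]) auto
  also have "\<dots> = (\<integral>\<^sup>+s\<in>{p'..q'}. h (c' s) \<partial>lborel)"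
    by (intro nn_integral_cong) (auto simp: indicator_def e_right w_def)
  finally have right: "(\<integral>\<^sup>+s\<in>{q..<w}. h (e s) \<partial>lborel) = (\<integral>\<^sup>+s\<in>{p'..q'}. h (c' s) \<partial>lborel)"
    by (simp add: set_nn_integral_Icc_eq_Ico)
  have "4 * (\<integral>\<^sup>+s\<in>{p..w}. h (e s) \<partial>lborel) =
      4 * (\<integral>\<^sup>+s\<in>{p..q}. h (c s) \<partial>lborel) + 4 * (\<integral>\<^sup>+s\<in>{p'..q'}. h (c' s) \<partial>lborel)"
    unfolding set_nn_integral_Icc_eq_Ico[of "\<lambda>s. h (e s)"] left[symmetric] right[symmetric]
    using \<open>p \<le> q\<close> w by (subst set_nn_integral_Ico_split[where b = q]) (auto simp: distrib_left)
  also have "\<dots> \<le> ennreal r + ennreal r'"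
    by (intro add_mono c c')
  finally show ?thesis
    using c c' w lip_e e_right[of w] w_def
    by (intro arc_cost_leI[of _ p w e]) (auto simp: e_def)
qed

text \<open>A 1-Lipschitz curve transports the Hajlasz inequality to the real line, where the
  interval estimate applies. So \<open>u\<close> is 1-Lipschitz for the path pseudometric on the set
  where \<open>h\<close> is finite.\<close>

lemma arc_cost_le_imp_hajlasz_bound:
  fixes u :: "'a::metric_space \<Rightarrow> real"
  assumes h: "h \<in> borel_measurable borel"
    and H: "\<And>x y. ennreal \<bar>u x - u y\<bar> \<le> ennreal (dist x y) * (h x + h y)"
    and "arc_cost_le h r x y" "h x < \<infinity>" "h y < \<infinity>"
  shows "\<bar>u x - u y\<bar> \<le> r"
proof -
  obtain c :: "real \<Rightarrow> 'a" and p q where c: "0 \<le> r" "p \<le> q" "1-lipschitz_on UNIV c" "c p = x" "c q = y"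
    "4 * (\<integral>\<^sup>+s\<in>{p..q}. h (c s) \<partial>lborel) \<le> ennreal r"
    using assms(3) by (rule arc_cost_leE)
  have "ennreal \<bar>u (c s) - u (c t)\<bar> \<le> ennreal \<bar>s - t\<bar> * (h (c s) + h (c t))" for s t
    using lipschitz_onD[OF c(3), of s t]
    by (intro order_trans[OF H] mult_right_mono ennreal_leI) (auto simp: dist_real_def)
  then have "ennreal \<bar>u (c p) - u (c q)\<bar> \<le> 4 * (\<integral>\<^sup>+s\<in>{p..q}. h (c s) \<partial>lborel)"
    using assms c by (intro hajlasz_interval borel_measurable_lipschitz_comp[OF h c(3)]) auto
  also have "\<dots> \<le> ennreal r" by fact
  finally show ?thesis using c by (simp add: ennreal_le_iff)
qed

text \<open>As \<open>x \<noteq> y\<close>, the parameter interval is nondegenerate, and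
  \<open>h\<close> has finite integral along the curve. Some point on it has \<open>h\<close> at
  most the average, hence finite; cutting the curve there does not raise its cost.\<close>

lemma arc_cost_le_reaches_finite:
  fixes h :: "'a::metric_space \<Rightarrow> ennreal"
  assumes h: "h \<in> borel_measurable borel" and "arc_cost_le h r x y" "x \<noteq> y"
  shows "\<exists>z. h z < \<infinity> \<and> arc_cost_le h r x z"
proof -
  obtain c :: "real \<Rightarrow> 'a" and p q where c: "0 \<le> r" "p \<le> q" "1-lipschitz_on UNIV c" "c p = x" "c q = y"
    "4 * (\<integral>\<^sup>+s\<in>{p..q}. h (c s) \<partial>lborel) \<le> ennreal r"
    using assms(2) by (rule arc_cost_leE)
  then have "p < q" using \<open>x \<noteq> y\<close> by (cases "p = q") auto
  have "(\<integral>\<^sup>+s\<in>{p..q}. h (c s) \<partial>lborel) \<noteq> \<infinity>"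
  proof
    assume "(\<integral>\<^sup>+s\<in>{p..q}. h (c s) \<partial>lborel) = \<infinity>"
    with c(6) show False by (simp add: ennreal_mult_top top_unique)
  qed
  then have fin: "(\<integral>\<^sup>+s\<in>{p..<q}. h (c s) \<partial>lborel) < \<infinity>"
    by (simp add: set_nn_integral_Icc_eq_Ico less_top)
  obtain t where t: "t \<in> {p..<q}"
    "ennreal (q - p) * h (c t) \<le> (\<integral>\<^sup>+s\<in>{p..<q}. h (c s) \<partial>lborel)"
    using exists_le_average[OF borel_measurable_lipschitz_comp[OF h c(3)] \<open>p < q\<close>] by blast
  have "h (c t) \<noteq> \<infinity>"
    using t fin \<open>p < q\<close> by (auto simp: ennreal_mult_top)
  moreover have "arc_cost_le h r x (c t)"
  proof (rule arc_cost_leI[of _ p t c])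
    have "(\<integral>\<^sup>+s\<in>{p..t}. h (c s) \<partial>lborel) \<le> (\<integral>\<^sup>+s\<in>{p..q}. h (c s) \<partial>lborel)"
      using t by (intro nn_integral_mono) (auto simp: indicator_def)
    then show "4 * (\<integral>\<^sup>+s\<in>{p..t}. h (c s) \<partial>lborel) \<le> ennreal r"
      using c(6) by (meson mult_left_mono order_trans zero_le)
  qed (use c t in auto)
  ultimately show ?thesis by (auto simp: less_top)
qed

text \<open>At points that no arc of finite cost connects to \<open>{h < \<infinity>}\<close> this is the junk value
  \<open>Inf {}\<close>.\<close>

definition mcshane_extension :: "('a::metric_space \<Rightarrow> ennreal) \<Rightarrow> ('a \<Rightarrow> real) \<Rightarrow> 'a \<Rightarrow> real" where
  "mcshane_extension h u x = Inf {u z + r | z r. h z < \<infinity> \<and> arc_cost_le h r x z}"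

text \<open>The candidate \<open>z = x\<close> with cost \<open>0\<close> attains the infimum, since
  by the Lipschitz bound no other candidate lies below \<open>u x\<close>.\<close>

lemma mcshane_extension_eq:
  assumes h: "h \<in> borel_measurable borel"
    and H: "\<And>x y. ennreal \<bar>u x - u y\<bar> \<le> ennreal (dist x y) * (h x + h y)"
    and x: "h x < \<infinity>"
  shows "mcshane_extension h u x = u x"
  unfolding mcshane_extension_def
proof (rule cInf_eq_minimum)
  show "u x \<in> {u z + r | z r. h z < \<infinity> \<and> arc_cost_le h r x z}"
    using x arc_cost_le_refl[of h x] by force
  show "u x \<le> v" if "v \<in> {u z + r | z r. h z < \<infinity> \<and> arc_cost_le h r x z}" for v
    using that arc_cost_le_imp_hajlasz_bound[OF h H _ x] by fastforce
qed

text \<open>Prefixing a curve from \<open>x\<close> to \<open>y\<close> turns every candidate for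
  \<open>y\<close> into one for \<open>x\<close> that is larger by \<open>r\<close>; symmetry gives
  the other direction.\<close>

lemma mcshane_extension_diff_le:
  assumes h: "h \<in> borel_measurable borel"
    and H: "\<And>x y. ennreal \<bar>u x - u y\<bar> \<le> ennreal (dist x y) * (h x + h y)"
    and xy: "arc_cost_le h r x y"
  shows "\<bar>mcshane_extension h u x - mcshane_extension h u y\<bar> \<le> r"
proof (cases "x = y")
  \<comment> \<open>Here both values may be junk, but they are the same, and \<open>r\<close> is
    nonnegative.\<close>
  case True
  then show ?thesis using xy by (simp add: arc_cost_le_def)
next
  case False
  have le: "mcshane_extension h u x \<le> mcshane_extension h u y + r"
    if xy: "arc_cost_le h r x y" and "x \<noteq> y" for x y
  proof -
    \<comment> \<open>\<open>z0\<close> makes the candidate set for \<open>y\<close> nonempty and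
      \<open>z1\<close> bounds the one for \<open>x\<close> from below, as the real
      \<open>Inf\<close> requires.\<close>
    obtain z0 where z0: "h z0 < \<infinity>" "arc_cost_le h r y z0"
      using arc_cost_le_reaches_finite[OF h arc_cost_le_sym[OF h xy]] \<open>x \<noteq> y\<close> by blast
    obtain z1 where z1: "h z1 < \<infinity>" "arc_cost_le h r x z1"
      using arc_cost_le_reaches_finite[OF h xy] \<open>x \<noteq> y\<close> by blast
    have bdd: "bdd_below {u z + r | z r. h z < \<infinity> \<and> arc_cost_le h r x z}"
    \<comment> \<open>Going from \<open>z1\<close> through \<open>x\<close> to any candidate
      \<open>z\<close> costs \<open>r + r'\<close>, hence
      \<open>u z1 - u z \<le> r + r'\<close>.\<close>
    proof (rule bdd_belowI[of _ "u z1 - r"])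
      fix v assume "v \<in> {u z + r | z r. h z < \<infinity> \<and> arc_cost_le h r x z}"
      then obtain z r' where v: "v = u z + r'" "h z < \<infinity>" "arc_cost_le h r' x z" by blast
      have "arc_cost_le h (r + r') z1 z"
        using arc_cost_le_trans[OF h arc_cost_le_sym[OF h z1(2)] v(3)] .
      then show "u z1 - r \<le> v"
        using arc_cost_le_imp_hajlasz_bound[OF h H _ z1(1) v(2)] v(1) by fastforce
    qed
    have "mcshane_extension h u x - r \<le> mcshane_extension h u y"
      unfolding mcshane_extension_def[of h u y]
    proof (rule cInf_greatest)
      show "{u z + r | z r. h z < \<infinity> \<and> arc_cost_le h r y z} \<noteq> {}" using z0 by blast
      fix v assume "v \<in> {u z + r | z r. h z < \<infinity> \<and> arc_cost_le h r y z}"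
      then obtain z r' where v: "v = u z + r'" "h z < \<infinity>" "arc_cost_le h r' y z" by blast
      then have "mcshane_extension h u x \<le> u z + (r + r')"
        unfolding mcshane_extension_def using arc_cost_le_trans[OF h xy v(3)]
        by (intro cInf_lower bdd) blast
      then show "mcshane_extension h u x - r \<le> v" using v by simp
    qed
    then show ?thesis by simp
  qed
  show ?thesis
    using le[OF xy False] le[OF arc_cost_le_sym[OF h xy]] False by auto
qed

section \<open>From rectifiable curves to the upper gradient inequality\<close>

lemma rectifiable_curve_imp_arc_cost_le:
  assumes \<gamma>: "rectifiable_curve \<gamma> a b" and "0 \<le> r"
    and r: "curve_integral \<gamma> a b (\<lambda>x. 4 * h x) \<le> ennreal r"
    and h: "h \<in> borel_measurable borel"
  shows "arc_cost_le h r (\<gamma> a) (\<gamma> b)"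
proof -
  define L where "L = enn2real (curve_length \<gamma> a b)"
  \<comment> \<open>Clamping to \<open>[0, L]\<close> extends the parametrisation to the line by its
    end values and keeps the Lipschitz constant 1.\<close>
  define c where "c s = arclength_param \<gamma> a b (max 0 (min L s))" for s
  have "0 \<le> L" by (simp add: L_def)
  have clamp: "max 0 (min L s) \<in> {0..L}" for s
    using \<open>0 \<le> L\<close> by auto
  have lip: "1-lipschitz_on UNIV c"
  proof (rule lipschitz_onI)
    fix s t
    have "dist (c s) (c t) \<le> \<bar>max 0 (min L s) - max 0 (min L t)\<bar>"
      unfolding c_def using clamp by (intro arclength_param_lipschitz[OF \<gamma>]) (auto simp: L_def)
    then show "dist (c s) (c t) \<le> 1 * dist s t"
      by (simp add: dist_real_def max_def min_def split: if_splits)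
  qed simp
  note [measurable] = borel_measurable_lipschitz_comp[OF h lip]
  have "curve_integral \<gamma> a b (\<lambda>x. 4 * h x) =
      (\<integral>\<^sup>+s\<in>{0..L}. 4 * h (c s) \<partial>lborel)"
    unfolding curve_integral_def L_def[symmetric] c_def
    by (intro nn_integral_cong) (auto simp: indicator_def max_def min_def)
  also have "\<dots> = 4 * (\<integral>\<^sup>+s\<in>{0..L}. h (c s) \<partial>lborel)"
    by (subst nn_integral_cmult[symmetric]) (auto simp: mult.assoc)
  finally show ?thesis
    using arclength_param_endpoints[OF \<gamma>] \<open>0 \<le> r\<close> \<open>0 \<le> L\<close> lip r
    by (intro arc_cost_leI[of r 0 L c]) (auto simp: c_def L_def[symmetric])
qed

lemma upper_gradient_mcshane_extension:
  fixes u :: "'a::metric_space \<Rightarrow> real"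
  assumes h: "h \<in> borel_measurable borel"
    and H: "\<And>x y. ennreal \<bar>u x - u y\<bar> \<le> ennreal (dist x y) * (h x + h y)"
  shows "upper_gradient (\<lambda>x. 4 * h x) (mcshane_extension h u)"
  unfolding upper_gradient_def
proof (intro conjI allI impI)
  show "(\<lambda>x. 4 * h x) \<in> borel_measurable borel" using h by measurable
  fix \<gamma> :: "real \<Rightarrow> 'a" and a b
  assume "rectifiable_curve \<gamma> a b \<and> \<not> \<gamma> constant_on {a..b}"
  then have \<gamma>: "rectifiable_curve \<gamma> a b" by simp
  let ?v = "mcshane_extension h u"
  show "ennreal \<bar>?v (\<gamma> a) - ?v (\<gamma> b)\<bar> \<le> curve_integral \<gamma> a b (\<lambda>x. 4 * h x)"
  \<comment> \<open>An infinite integral bounds everything; a finite one is itself an admissible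
    cost \<open>r\<close>.\<close>
  proof (cases "curve_integral \<gamma> a b (\<lambda>x. 4 * h x)")
    case (real r)
    then have "\<bar>?v (\<gamma> a) - ?v (\<gamma> b)\<bar> \<le> r"
      using rectifiable_curve_imp_arc_cost_le[OF \<gamma> _ _ h]
      by (intro mcshane_extension_diff_le[OF h H]) auto
    then show ?thesis using real by (simp add: ennreal_leI)
  qed simp
qed

section \<open>Borel regular measures\<close>

text \<open>Zorn's lemma: a point of \<open>Y\<close> outside all the balls could be added to a
  maximal separated set.\<close>

lemma maximal_separated_subset:
  fixes Y :: "'a::metric_space set"
  assumes "e > 0"
  obtains S where "S \<subseteq> Y" "\<And>s t. s \<in> S \<Longrightarrow> t \<in> S \<Longrightarrow> s \<noteq> t \<Longrightarrow> e \<le> dist s t"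
    "Y \<subseteq> (\<Union>s\<in>S. ball s e)"
proof -
  define F where "F = {S. S \<subseteq> Y \<and> (\<forall>s\<in>S. \<forall>t\<in>S. s \<noteq> t \<longrightarrow> e \<le> dist s t)}"
  have "\<exists>M\<in>F. \<forall>X\<in>F. M \<subseteq> X \<longrightarrow> X = M"
  proof (rule subset_Zorn')
    fix C assume C: "subset.chain F C"
    have "\<exists>B\<in>C. s \<in> B \<and> t \<in> B" if "s \<in> \<Union>C" "t \<in> \<Union>C" for s t
      using that C unfolding subset_chain_def by blast
    moreover have "C \<subseteq> F" using C by (simp add: subset_chain_def)
    ultimately show "\<Union>C \<in> F"
      unfolding F_def by (simp, blast)
  qed
  then obtain S where S: "S \<in> F" "\<And>X. X \<in> F \<Longrightarrow> S \<subseteq> X \<Longrightarrow> X = S" by blast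
  have "\<exists>s\<in>S. y \<in> ball s e" if "y \<in> Y" for y
  proof (rule ccontr)
    assume "\<not> ?thesis"
    then have "e \<le> dist s y" if "s \<in> S" for s using that by force
    then have "insert y S \<in> F"
      using S(1) \<open>y \<in> Y\<close> by (auto simp: F_def dist_commute)
    then have "y \<in> S" using S(2) by blast
    with \<open>\<not> ?thesis\<close> \<open>e > 0\<close> show False by force
  qed
  then have "Y \<subseteq> (\<Union>s\<in>S. ball s e)" by blast
  with S(1) show ?thesis by (intro that[of S]) (simp_all add: F_def)
qed

text \<open>The balls of radius \<open>e / 2\<close> are disjoint and lie in one bounded ball of
  finite measure, so their measures are summable over \<open>S\<close>. Only countably many terms of
  a summable family are nonzero, yet all of these are.\<close>

lemma countable_separated_subset:
  fixes M :: "'a::metric_space measure" and S :: "'a set"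
  assumes borel: "sets borel \<subseteq> sets M"
    and fin: "\<And>A. bounded A \<Longrightarrow> emeasure M A < \<infinity>"
    and pos: "\<And>U. open U \<Longrightarrow> U \<noteq> {} \<Longrightarrow> emeasure M U > 0"
    and "e > 0" and sep: "\<And>s t. s \<in> S \<Longrightarrow> t \<in> S \<Longrightarrow> s \<noteq> t \<Longrightarrow> e \<le> dist s t"
    and "bounded S"
  shows "countable S"
proof -
  define m where "m s = measure M (ball s (e / 2))" for s
  obtain x0 R where R: "S \<subseteq> ball x0 R"
    using \<open>bounded S\<close> by (metis bounded_subset_ballD)
  have sets: "ball x r \<in> sets M" for x r using borel by auto
  have fm: "ball x r \<in> fmeasurable M" for x r
    using sets fin[of "ball x r"] by (auto intro!: fmeasurableI)
  have "m summable_on S"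
  proof (rule nonneg_bdd_above_summable_on)
    show "bdd_above (sum m ` {F. F \<subseteq> S \<and> finite F})"
    proof (rule bdd_aboveI2)
      fix F assume "F \<in> {F. F \<subseteq> S \<and> finite F}"
      then have F: "F \<subseteq> S" "finite F" by auto
      have disj: "ball s (e / 2) \<inter> ball t (e / 2) = {}" if "s \<in> F" "t \<in> F" "s \<noteq> t" for s t
      proof -
        have "\<not> (dist s y < e / 2 \<and> dist t y < e / 2)" for y
          using sep[of s t] that F dist_triangle2[of s t y] by force
        then show ?thesis by auto
      qed
      have "sum m F = measure M (\<Union>s\<in>F. ball s (e / 2))"
        unfolding m_def using F disj fm
        by (intro measure_UNION'[symmetric]) (auto simp: pairwise_def disjnt_def)
      also have "\<dots> \<le> measure M (ball x0 (R + e))"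
      proof (rule measure_mono_fmeasurable[OF _ _ fm])
        have "dist x0 y < R + e" if "s \<in> F" "dist s y < e / 2" for s y
        proof -
          have "dist x0 s < R" using R F that(1) by auto
          then show ?thesis
            using that(2) dist_triangle[of x0 y s] \<open>e > 0\<close> by linarith
        qed
        then show "(\<Union>s\<in>F. ball s (e / 2)) \<subseteq> ball x0 (R + e)" by auto
        show "(\<Union>s\<in>F. ball s (e / 2)) \<in> sets M" using F sets by auto
      qed
      finally show "sum m F \<le> measure M (ball x0 (R + e))" .
    qed
  qed (simp add: m_def)
  then have "countable {s\<in>S. m s \<noteq> 0}" by (rule summable_countable_real)
  moreover have "m s \<noteq> 0" for s
  proof -
    have "emeasure M (ball s (e / 2)) \<noteq> 0" "emeasure M (ball s (e / 2)) \<noteq> \<infinity>"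
      using pos[of "ball s (e / 2)"] fin[OF bounded_ball, of s "e / 2"] \<open>e > 0\<close> by auto
    then show ?thesis
      by (simp add: m_def measure_def enn2real_eq_0_iff)
  qed
  ultimately show ?thesis by simp
qed

text \<open>Takes the place of a Lindelof argument, as separability is not assumed. Points are
  sorted by distance from a base point and by a radius on which \<open>A\<close> is null; each class
  is covered by balls of that radius around a maximal separated, hence countable, subset of
  itself.\<close>

lemma null_sets_if_locally_null:
  fixes M :: "'a::metric_space measure"
  assumes borel: "sets borel \<subseteq> sets M"
    and fin: "\<And>A. bounded A \<Longrightarrow> emeasure M A < \<infinity>"
    and pos: "\<And>U. open U \<Longrightarrow> U \<noteq> {} \<Longrightarrow> emeasure M U > 0"
    and loc: "\<And>x. \<exists>r>0. A \<inter> ball x r \<in> null_sets M"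
  shows "A \<in> null_sets M"
proof -
  define x0 :: 'a where "x0 = undefined"
  define Y where "Y n k = {x \<in> ball x0 (real n). A \<inter> ball x (1 / real (Suc k)) \<in> null_sets M}" for n k
  have cover: "\<exists>S. countable S \<and> S \<subseteq> Y n k \<and> Y n k \<subseteq> (\<Union>s\<in>S. ball s (1 / real (Suc k)))" for n k
  proof -
    obtain S where S: "S \<subseteq> Y n k" "\<And>s t. s \<in> S \<Longrightarrow> t \<in> S \<Longrightarrow> s \<noteq> t \<Longrightarrow> 1 / real (Suc k) \<le> dist s t"
      "Y n k \<subseteq> (\<Union>s\<in>S. ball s (1 / real (Suc k)))"
      by (rule maximal_separated_subset[of "1 / real (Suc k)" "Y n k"]) auto
    moreover have "bounded S"
      using S(1) by (intro bounded_subset[OF bounded_ball, of _ x0 "real n"]) (auto simp: Y_def)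
    ultimately show ?thesis
      using countable_separated_subset[OF borel fin pos, of "1 / real (Suc k)" S] by auto
  qed
  obtain S where S: "\<And>n k. countable (S n k)" "\<And>n k. S n k \<subseteq> Y n k"
    "\<And>n k. Y n k \<subseteq> (\<Union>s\<in>S n k. ball s (1 / real (Suc k)))"
    using cover by metis
  have "A \<inter> ball s (1 / real (Suc k)) \<in> null_sets M" if "s \<in> S n k" for s n k
    using S(2) that unfolding Y_def by blast
  then have null: "(\<Union>n. \<Union>k. \<Union>s\<in>S n k. A \<inter> ball s (1 / real (Suc k))) \<in> null_sets M"
    using S(1) by (intro null_sets_UN null_sets_UN') auto
  have "A = (\<Union>n. \<Union>k. \<Union>s\<in>S n k. A \<inter> ball s (1 / real (Suc k)))"
  proof (intro equalityI subsetI)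
    fix x assume "x \<in> A"
    obtain r where r: "r > 0" "A \<inter> ball x r \<in> null_sets M" using loc[of x] by blast
    obtain k where k: "1 / real (Suc k) < r"
      using r(1) nat_approx_posE by metis
    obtain n where n: "dist x0 x < real n"
      using reals_Archimedean2 by blast
    have "A \<inter> ball x r \<inter> ball x (1 / real (Suc k)) \<in> null_sets M"
      using borel by (intro null_set_Int2[OF r(2)]) auto
    moreover have "A \<inter> ball x r \<inter> ball x (1 / real (Suc k)) = A \<inter> ball x (1 / real (Suc k))"
      using k by auto
    ultimately have "x \<in> Y n k" using n by (simp add: Y_def)
    then obtain s where "s \<in> S n k" "x \<in> ball s (1 / real (Suc k))"
      using S(3)[of n k] by blast
    then show "x \<in> (\<Union>n. \<Union>k. \<Union>s\<in>S n k. A \<inter> ball s (1 / real (Suc k)))"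
      using \<open>x \<in> A\<close> by (intro UN_I[of n] UN_I[of k] UN_I[of s]) simp_all
  qed blast
  then show ?thesis using null by simp
qed

text \<open>The part of \<open>A\<close> inside \<open>N\<close> is null by monotonicity, and
  subadditivity leaves the full measure to the part outside. Completeness of the measure rests on
  this.\<close>

lemma null_in_lambda_system:
  assumes "outer_measure_space (Pow UNIV) \<mu>" "\<mu> N = 0"
  shows "N \<in> lambda_system UNIV (Pow UNIV) \<mu>"
proof -
  have pos: "positive (Pow UNIV) \<mu>" and inc: "increasing (Pow UNIV) \<mu>"
    and "countably_subadditive (Pow UNIV) \<mu>"
    using assms(1) by (auto simp: outer_measure_space_def)
  then have sub: "subadditive (Pow UNIV) \<mu>"
    using ring_of_sets.countably_subadditive_subadditive[OF ring_of_sets_Pow] by blast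
  have "\<mu> (N \<inter> A) + \<mu> ((UNIV - N) \<inter> A) = \<mu> A" for A
  proof (rule antisym)
    have "\<mu> (N \<inter> A) \<le> 0"
      using increasingD[OF inc, of "N \<inter> A" N] assms(2) by auto
    then show "\<mu> (N \<inter> A) + \<mu> ((UNIV - N) \<inter> A) \<le> \<mu> A"
      using increasingD[OF inc, of "(UNIV - N) \<inter> A" A] by auto
    have "(N \<inter> A) \<union> ((UNIV - N) \<inter> A) = A" by auto
    then show "\<mu> A \<le> \<mu> (N \<inter> A) + \<mu> ((UNIV - N) \<inter> A)"
      using subadditiveD[OF sub, of "N \<inter> A" "(UNIV - N) \<inter> A"] by fastforce
  qed
  then show ?thesis by (simp add: lambda_system_def)
qed

section \<open>Borel sets versus Caratheodory measurable sets\<close>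

context
  fixes \<mu> :: "'a::metric_space set \<Rightarrow> ennreal"
  assumes reg: "borel_regular \<mu>"
begin

lemma outer_measure_space_of_borel_regular: "outer_measure_space (Pow UNIV) \<mu>"
  using reg by (simp add: borel_regular_def)

lemma borel_sets_carath_measure: "sets borel \<subseteq> sets (carath_measure \<mu>)"
  using reg by (simp add: borel_regular_def sets_carath_measure)

lemma emeasure_carath_measure':
  "A \<in> sets (carath_measure \<mu>) \<Longrightarrow> emeasure (carath_measure \<mu>) A = \<mu> A"
  using emeasure_carath_measure[OF outer_measure_space_of_borel_regular]
    sets_carath_measure[OF outer_measure_space_of_borel_regular] by blast

lemma null_sets_carath_measure: "null_sets (carath_measure \<mu>) = {N. \<mu> N = 0}"
  using emeasure_carath_measure' null_in_lambda_system[OF outer_measure_space_of_borel_regular]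
    sets_carath_measure[OF outer_measure_space_of_borel_regular]
  by (auto simp: null_sets_def)

lemma complete_carath_measure: "complete_measure (carath_measure \<mu>)"
proof
  fix A B :: "'a set" assume "B \<subseteq> A" "A \<in> null_sets (carath_measure \<mu>)"
  moreover have "increasing (Pow UNIV) \<mu>"
    using outer_measure_space_of_borel_regular by (simp add: outer_measure_space_def)
  ultimately have "\<mu> B \<le> 0"
    using increasingD[of "Pow UNIV" \<mu> B A] by (simp add: null_sets_carath_measure)
  then have "B \<in> null_sets (carath_measure \<mu>)" by (simp add: null_sets_carath_measure)
  then show "B \<in> sets (carath_measure \<mu>)" by auto
qed

lemma borel_hull:
  obtains B where "B \<in> sets borel" "A \<subseteq> B" "\<mu> B = \<mu> A"
  using reg unfolding borel_regular_def by blast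

text \<open>The restriction of the measure to the Borel sets, as a pushforward under the identity.
  Its completion serves to find Borel representatives.\<close>

definition borel_part :: "'a measure" where
  "borel_part = distr (carath_measure \<mu>) borel (\<lambda>x. x)"

lemma sets_borel_part: "sets borel_part = sets borel"
  by (simp add: borel_part_def)

lemma space_borel_part: "space borel_part = UNIV"
  by (simp add: borel_part_def)

lemma emeasure_borel_part:
  assumes "B \<in> sets borel"
  shows "emeasure borel_part B = \<mu> B"
proof -
  have "(\<lambda>x. x) \<in> measurable (carath_measure \<mu>) borel"
    using borel_sets_carath_measure by (auto simp: measurable_def)
  then show ?thesis
    using assms borel_sets_carath_measure
    by (auto simp: borel_part_def emeasure_distr emeasure_carath_measure')
qed

lemma null_sets_borel_part: "N \<in> null_sets borel_part \<longleftrightarrow> N \<in> sets borel \<and> \<mu> N = 0"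
  by (auto simp: null_sets_def sets_borel_part emeasure_borel_part)

text \<open>Cutting by balls makes the measure finite, so that a set \<open>D\<close> and its Borel
  hull \<open>B\<close> differ by a null set, which in turn has a Borel null hull. Thus
  \<open>D\<close>, being \<open>B\<close> minus that difference, lies in the completion.\<close>

lemma sets_carath_measure_subset_completion:
  assumes fin: "\<And>A. bounded A \<Longrightarrow> \<mu> A < \<infinity>"
  shows "sets (carath_measure \<mu>) \<subseteq> sets (completion borel_part)"
proof
  fix A assume A: "A \<in> sets (carath_measure \<mu>)"
  define x0 :: 'a where "x0 = undefined"
  have "A \<inter> ball x0 (real n) \<in> sets (completion borel_part)" for n
  proof -
    define D where "D = A \<inter> ball x0 (real n)"
    have D: "D \<in> sets (carath_measure \<mu>)"
      unfolding D_def using A borel_sets_carath_measure by (intro sets.Int) auto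
    have "\<mu> D < \<infinity>" unfolding D_def by (intro fin bounded_subset[OF bounded_ball]) auto
    obtain B where B: "B \<in> sets borel" "D \<subseteq> B" "\<mu> B = \<mu> D" by (rule borel_hull)
    have BM: "B \<in> sets (carath_measure \<mu>)" using B borel_sets_carath_measure by auto
    have "emeasure (carath_measure \<mu>) (B - D) = 0"
      using B D BM \<open>\<mu> D < \<infinity>\<close> by (subst emeasure_Diff) (auto simp: emeasure_carath_measure')
    then have "\<mu> (B - D) = 0"
      using D BM by (simp add: emeasure_carath_measure' sets.Diff)
    then obtain N where N: "N \<in> sets borel" "B - D \<subseteq> N" "\<mu> N = 0"
      using borel_hull[of "B - D"] by metis
    then have "N \<in> null_sets borel_part"
      by (simp add: null_sets_borel_part)
    then have "B - D \<in> sets (completion borel_part)"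
      using N by (intro null_sets_completion[of N])
    with B(1) have "B - (B - D) \<in> sets (completion borel_part)"
      by (intro sets.Diff[of B _ "B - D"]) (simp_all add: sets_borel_part)
    then show ?thesis using B by (simp add: double_diff flip: D_def)
  qed
  then have "(\<Union>n. A \<inter> ball x0 (real n)) \<in> sets (completion borel_part)"
    by (intro sets.countable_UN) auto
  moreover have "A = (\<Union>n. A \<inter> ball x0 (real n))"
    using reals_Archimedean2 by auto
  ultimately show "A \<in> sets (completion borel_part)" by simp
qed

text \<open>A function measurable for the completion agrees almost everywhere with a Borel one. The
  exceptional set is delivered inside a Borel null set, so that further changes on it keep the
  function Borel.\<close>

lemma ex_borel_representative:
  fixes g :: "'a \<Rightarrow> ennreal"
  assumes fin: "\<And>A. bounded A \<Longrightarrow> \<mu> A < \<infinity>"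
    and g: "g \<in> borel_measurable (carath_measure \<mu>)"
  obtains g' N where "g' \<in> borel_measurable borel" "N \<in> sets borel" "\<mu> N = 0"
    "\<And>x. x \<notin> N \<Longrightarrow> g' x = g x"
proof -
  have "g \<in> borel_measurable (completion borel_part)"
    using g sets_carath_measure_subset_completion[OF fin]
    by (auto simp: measurable_def space_borel_part)
  then obtain g' where g': "g' \<in> borel_measurable borel_part" "AE x in borel_part. g x = g' x"
    using completion_ex_borel_measurable by blast
  obtain N where N: "N \<in> null_sets borel_part" "{x. g x \<noteq> g' x} \<subseteq> N"
    using g'(2) by (auto simp: eventually_ae_filter space_borel_part)
  have "g' \<in> borel_measurable borel"
    using g'(1) by (simp add: sets_borel_part cong: measurable_cong_sets)
  then show ?thesis
    using N by (intro that[of g' N]) (force simp: null_sets_borel_part)+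
qed

lemma AE_carath_measureI: "\<mu> N = 0 \<Longrightarrow> (\<And>x. x \<notin> N \<Longrightarrow> P x) \<Longrightarrow> AE x in carath_measure \<mu>. P x"
  by (rule AE_I'[of N]) (auto simp: null_sets_carath_measure)

text \<open>Measurability of \<open>v\<close> is not given, and for an infimum over uncountably many
  curves it is not evident. It comes from completeness: preimages under \<open>u\<close> and
  \<open>v\<close> differ by null sets.\<close>

lemma L1_loc_cong_AE:
  assumes "L1_loc (carath_measure \<mu>) u" and ae: "AE x in carath_measure \<mu>. v x = u x"
  shows "L1_loc (carath_measure \<mu>) v"
proof -
  interpret complete_measure "carath_measure \<mu>"
    by (rule complete_carath_measure)
  have meas: "u \<in> borel_measurable (carath_measure \<mu>)"
    using assms by (simp add: L1_loc_def)
  then have meas': "v \<in> borel_measurable (carath_measure \<mu>)"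
  proof (intro measurableI)
    fix A :: "real set" assume "A \<in> sets borel"
    then have "u -` A \<inter> space (carath_measure \<mu>) \<in> sets (carath_measure \<mu>)"
      by (rule measurable_sets[OF meas])
    moreover have "AE x in carath_measure \<mu>.
        x \<in> u -` A \<inter> space (carath_measure \<mu>) \<longleftrightarrow> x \<in> v -` A \<inter> space (carath_measure \<mu>)"
      using ae by eventually_elim simp
    ultimately show "v -` A \<inter> space (carath_measure \<mu>) \<in> sets (carath_measure \<mu>)"
      using in_sets_AE by blast
  qed simp
  have ball: "ball x r \<in> sets (carath_measure \<mu>)" for x r
    using borel_sets_carath_measure by auto
  have "set_integrable (carath_measure \<mu>) (ball x r) u \<longleftrightarrow>
    set_integrable (carath_measure \<mu>) (ball x r) v" for x r
    unfolding set_integrable_def using ae ball meas meas'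
    by (intro integrable_cong_AE) auto
  then show ?thesis using assms(1) meas' by (simp add: L1_loc_def)
qed

lemma L1_loc_ennreal_cong_AE:
  assumes "L1_loc_ennreal (carath_measure \<mu>) g" and ae: "AE x in carath_measure \<mu>. h x = g x"
    and "h \<in> borel_measurable (carath_measure \<mu>)"
  shows "L1_loc_ennreal (carath_measure \<mu>) h"
proof -
  have "(\<integral>\<^sup>+y\<in>ball x r. h y \<partial>carath_measure \<mu>) = (\<integral>\<^sup>+y\<in>ball x r. g y \<partial>carath_measure \<mu>)" for x r
    using ae by (intro nn_integral_cong_AE) auto
  then show ?thesis using assms by (simp add: L1_loc_ennreal_def)
qed

text \<open>Near each point the integral is finite, so \<open>g\<close> is finite almost everywhere
  there; locally null sets are null.\<close>

lemma L1_loc_ennreal_infinity_null: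
  assumes fin: "\<And>A. bounded A \<Longrightarrow> \<mu> A < \<infinity>"
    and pos: "\<And>U. open U \<Longrightarrow> U \<noteq> {} \<Longrightarrow> \<mu> U > 0"
    and g: "L1_loc_ennreal (carath_measure \<mu>) g"
  shows "\<mu> {x. g x = \<infinity>} = 0"
proof -
  let ?M = "carath_measure \<mu>"
  have borel: "sets borel \<subseteq> sets ?M" by (rule borel_sets_carath_measure)
  have meas[measurable]: "g \<in> borel_measurable ?M"
    using g by (simp add: L1_loc_ennreal_def)
  have "{x. g x = \<infinity>} \<in> null_sets ?M"
  proof (rule null_sets_if_locally_null[OF borel])
    fix A :: "'a set" assume "bounded A"
    \<comment> \<open>The bound is wanted for every bounded set; nonmeasurable ones have
      \<open>emeasure\<close> zero by convention.\<close>
    then show "emeasure ?M A < \<infinity>"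
      using fin emeasure_carath_measure'[of A]
      by (cases "A \<in> sets ?M") (auto simp: emeasure_notin_sets)
  next
    fix U :: "'a set" assume "open U" "U \<noteq> {}"
    moreover have "U \<in> sets ?M" using borel \<open>open U\<close> by auto
    ultimately show "emeasure ?M U > 0"
      using pos emeasure_carath_measure'[of U] by simp
  next
    fix x
    obtain r where r: "r > 0" "(\<integral>\<^sup>+y\<in>ball x r. g y \<partial>?M) < \<infinity>"
      using g unfolding L1_loc_ennreal_def by blast
    have [measurable]: "ball x r \<in> sets ?M" using borel by auto
    have "AE y in ?M. g y * indicator (ball x r) y \<noteq> \<infinity>"
      using r(2) by (intro nn_integral_PInf_AE) auto
    then have "{y \<in> space ?M. \<not> g y * indicator (ball x r) y \<noteq> \<infinity>} \<in> null_sets ?M"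
      by (simp only: complete_measure.AE_iff_null_sets[OF complete_carath_measure])
    moreover have "{y \<in> space ?M. \<not> g y * indicator (ball x r) y \<noteq> \<infinity>} = {x. g x = \<infinity>} \<inter> ball x r"
      by (auto simp: indicator_def split: if_splits)
    ultimately show "\<exists>r>0. {x. g x = \<infinity>} \<inter> ball x r \<in> null_sets ?M"
      using r(1) by metis
  qed
  then show ?thesis by (simp add: null_sets_carath_measure)
qed

end

section \<open>Choice of the two representatives\<close>

theorem theorem1p3:
  fixes \<mu> :: "'a::metric_space set \<Rightarrow> ennreal"
    and u :: "'a \<Rightarrow> real"
    and g :: "'a \<Rightarrow> ennreal"
  assumes "borel_regular \<mu>"
    and "\<mu> UNIV \<noteq> 0"
    and "\<And>A. bounded A \<Longrightarrow> \<mu> A < \<infinity>"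
    and "\<And>U. open U \<Longrightarrow> U \<noteq> {} \<Longrightarrow> \<mu> U > 0"
    and "L1_loc (carath_measure \<mu>) u"
    and "L1_loc_ennreal (carath_measure \<mu>) g"
    and "hajlasz_gradient \<mu> g u"
  shows "\<exists>u' g'.
    L1_loc (carath_measure \<mu>) u' \<and>
    L1_loc_ennreal (carath_measure \<mu>) g' \<and>
    (AE x in carath_measure \<mu>. u' x = u x) \<and>
    (AE x in carath_measure \<mu>. g' x = g x) \<and>
    upper_gradient (\<lambda>x. 4 * g' x) u'"
proof -
  note reg = assms(1)
  obtain E where E: "\<mu> E = 0"
    "\<And>x y. x \<notin> E \<Longrightarrow> y \<notin> E \<Longrightarrow> ennreal \<bar>u x - u y\<bar> \<le> ennreal (dist x y) * (g x + g y)"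
    using assms(7) unfolding hajlasz_gradient_def by blast
  \<comment> \<open>A Borel hull of the exceptional set, so that redefining the gradient on it
    preserves Borel measurability.\<close>
  obtain E' where E': "E' \<in> sets borel" "E \<subseteq> E'" "\<mu> E' = 0"
    using borel_hull[OF reg, of E] E(1) by metis
  obtain f N where f: "f \<in> borel_measurable borel" "N \<in> sets borel" "\<mu> N = 0"
    "\<And>x. x \<notin> N \<Longrightarrow> f x = g x"
    using ex_borel_representative[OF reg assms(3), of g] assms(6)
    unfolding L1_loc_ennreal_def by metis
  define h where "h x = (if x \<in> E' \<union> N then \<infinity> else f x)" for x
  define v where "v = mcshane_extension h u"
  have h: "h \<in> borel_measurable borel"
    unfolding h_def using f E' by measurable
  have null: "\<mu> (E' \<union> N) = 0"
    using null_sets.Un[of E' "carath_measure \<mu>" N] E' f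
    by (simp add: null_sets_carath_measure[OF reg])
  have h_ae: "AE x in carath_measure \<mu>. h x = g x"
    using f by (intro AE_carath_measureI[OF reg null]) (auto simp: h_def)
  have h_loc: "L1_loc_ennreal (carath_measure \<mu>) h"
    using h borel_sets_carath_measure[OF reg]
    by (intro L1_loc_ennreal_cong_AE[OF reg assms(6) h_ae]) (auto simp: measurable_def)
  have H: "ennreal \<bar>u x - u y\<bar> \<le> ennreal (dist x y) * (h x + h y)" for x y
  proof (cases "x = y \<or> x \<in> E' \<union> N \<or> y \<in> E' \<union> N")
    \<comment> \<open>If \<open>x = y\<close>, the left side is zero, but so may be the right, as
      \<open>0 * \<infinity> = 0\<close>; otherwise a positive distance times
      \<open>\<infinity>\<close> makes the right side infinite.\<close>
    case True
    then show ?thesis by (auto simp: h_def ennreal_mult_top)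
  next
    case False
    then show ?thesis using E(2)[of x y] E'(2) f(4) by (auto simp: h_def)
  qed
  \<comment> \<open>The extension agrees with \<open>u\<close> wherever \<open>h\<close> is finite,
    and \<open>{x. h x = \<infinity>}\<close> is null because \<open>h\<close> inherits local
    integrability from \<open>g\<close>.\<close>
  have v_ae: "AE x in carath_measure \<mu>. v x = u x"
    unfolding v_def using mcshane_extension_eq[OF h H]
    by (intro AE_carath_measureI[OF reg L1_loc_ennreal_infinity_null[OF reg assms(3,4) h_loc]])
      (auto simp: less_top)
  have "upper_gradient (\<lambda>x. 4 * h x) v"
    unfolding v_def by (rule upper_gradient_mcshane_extension[OF h H])
  then show ?thesis
    using L1_loc_cong_AE[OF reg assms(5) v_ae] h_loc v_ae h_ae by blast
qed

end
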